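(* Let $v$ be a weight function on $\mathbb Z$ and let $K_\sigma$ be a pseudodifferential operator defined on $\ell^2(\mathbb Z)$ with Kohn-Nirenberg symbol $\sigma$ on $\mathbb Z\times\mathbb T$. Then the matrix corresponding to $K_\sigma$ (the matrix $A=[A_{x,u}]_{x,u\in\mathbb Z}$ with $K_\sigma f(x)=\sum_{u\in\mathbb Z}A_{x,u}f(u)$) is in $\mathcal C_v(\mathbb Z)$ if and only if $\mathcal T_2\sigma\in M^{\infty,1}_{(v\otimes1)\circ\mathcal J^{-1}}(\mathbb Z\times\mathbb T)$, where $\mathcal T_2\sigma(x,\xi):=\sigma(x,-\xi)$.
   Context: Here $G=\mathbb Z$, $\hat G=\mathbb T=\mathbb R/\mathbb Z$, with $\langle\xi,x\rangle=e^{2\pi i x\xi}$, counting measure on $\mathbb Z$ and normalized Haar measure on $\mathbb T$; $\hat f(\xi)=\sum_{x\in\mathbb Z}f(x)e^{-2\pi i x\xi}$. The dual of $\mathbb Z\times\mathbb T$ is $\mathbb T\times\mathbb Z$, where $(\omega,u)$ acts by $(x,\xi)\mapsto e^{2\pi i(x\omega+\xi u)}$. Weight function on $\mathbb Z$: a non-negative function $v$ that is even, normalized by $v(0)=1$, submultiplicative ($v(x+y)\le v(x)v(y)$) and satisfies $\lim_{n\to\infty}v(nx)^{1/n}=1$ for all $x$ (admissible weight). $(v\otimes1)(x,\xi)=v(x)$ on $\mathbb Z\times\mathbb T$. $\mathcal C_v(\mathbb Z)$ is the set of matrices $A=[A_{i,j}]_{i,j\in\mathbb Z}$ with $\|A\|_{\mathcal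 C_v(\mathbb Z)}=\sum_{j\in\mathbb Z}\sup_{i\in\mathbb Z}|A_{i,i-j}|\,v(j)<\infty$. Kohn-Nirenberg operator: $(K_\sigma f)(x)=\int_{\mathbb T}\sigma(x,\xi)\hat f(\xi)e^{2\pi i x\xi}\,d\xi$, for a symbol $\sigma\in M^\infty(\mathbb Z\times\mathbb T)$ (defined weakly when $\sigma$ is a distribution). STFT on $\mathbb Z\times\mathbb T$: $V_\Psi\sigma(\mathbf x,\boldsymbol\omega)=\langle\sigma,M_{\boldsymbol\omega}T_{\mathbf x}\Psi\rangle$, $\mathbf x\in\mathbb Z\times\mathbb T$, $\boldsymbol\omega\in\mathbb T\times\mathbb Z$, with $T_{\mathbf x}F(\mathbf z)=F(\mathbf z-\mathbf x)$ and $M_{\boldsymbol\omega}$ multiplication by the character $\boldsymbol\omega$. One may take the window $\Psi=\chi_{\{0\}\times\mathbb T}$ (any other nonzero finite linear combination of its time-frequency shifts gives equivalent norms). $M^1(\mathbb Z\times\mathbb T)$ is the completion of the span of the time-frequency shifts of $\Psi$ in the norm $\|V_\Psi F\|_{L^1}$; $M^\infty(\mathbb Z\times\mathbb T)$ is its dual (conjugate-linear functionals). $\mathcal J:\mathbb Z\times\mathbb T\to\mathbb T\times\mathbb Z$, $\mathcal J(x,\xi)=(-\xi,x)$. $M^{\infty,1}_{(v\otimes1)\circ\mathcal J^{-1}}(\mathbb Z\times\mathbb T)$ is the set of $\sigma\in M^\infty(\mathbb Z\times\mathbb T)$ with $\sum_{u\in\mathbb Z}\int_{\mathbb T}\sup_{\mathbf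 x\in\mathbb Z\times\mathbb T}|V_\Psi\sigma(\mathbf x,(\omega,u))|\,(v\otimes1)(\mathcal J^{-1}(\omega,u))\,d\omega<\infty$. *)

theory Defs
  imports "HOL-Analysis.Analysis"
begin

text \<open>
  Functions on \<open>\<int> \<times> \<real>/\<int>\<close> are functions on \<^typ>\<open>int \<times> real\<close> that are 1-periodic in the
  second variable; the circle carries Lebesgue measure on the fundamental domain \<open>[0,1)\<close>.
\<close>

definition admissible_weight :: "(int \<Rightarrow> real) \<Rightarrow> bool" where
  "admissible_weight v \<longleftrightarrow>
     (\<forall>x. v x \<ge> 0) \<and> (\<forall>x. v (- x) = v x) \<and> v 0 = 1 \<and>
     (\<forall>x y. v (x + y) \<le> v x * v y) \<and>
     (\<forall>x. (\<lambda>n. root n (v (int n * x))) \<longlonglongrightarrow> 1)"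

definition C_class :: "(int \<Rightarrow> real) \<Rightarrow> (int \<Rightarrow> int \<Rightarrow> complex) set" where
  "C_class v =
     {A. (\<Sum>\<^sub>\<infinity>j. (SUP i. ennreal (cmod (A i (i - j)))) * ennreal (v j)) < \<infinity>}"

definition e2pi :: "real \<Rightarrow> complex" where
  "e2pi t = cis (2 * pi * t)"

definition circle :: "real measure" where
  "circle = restrict_space lborel {0..<1}"

definition ZT :: "(int \<times> real) measure" where
  "ZT = count_space UNIV \<Otimes>\<^sub>M circle"

definition TZ :: "(real \<times> int) measure" where
  "TZ = circle \<Otimes>\<^sub>M count_space UNIV"

definition translate :: "int \<times> real \<Rightarrow> (int \<times> real \<Rightarrow> complex) \<Rightarrow> int \<times> real \<Rightarrow> complex" where
  "translate a F = (\<lambda>z. F (z - a))"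

definition modulate :: "real \<times> int \<Rightarrow> (int \<times> real \<Rightarrow> complex) \<Rightarrow> int \<times> real \<Rightarrow> complex" where
  "modulate = (\<lambda>(\<omega>, u) F (x, \<xi>). e2pi (of_int x * \<omega> + \<xi> * of_int u) * F (x, \<xi>))"

definition window :: "int \<times> real \<Rightarrow> complex" where
  "window = indicator ({0} \<times> UNIV)"

type_synonym functional = "(int \<times> real \<Rightarrow> complex) \<Rightarrow> complex"

text \<open>A function acts on test functions through the \<open>L\<^sup>2\<close> pairing, conjugate-linearly in the test
  function.\<close>

definition functional_of :: "(int \<times> real \<Rightarrow> complex) \<Rightarrow> functional" where
  "functional_of F = (\<lambda>G. \<integral>z. F z * cnj (G z) \<partial>ZT)"

definition stft :: "functional \<Rightarrow> int \<times> real \<Rightarrow> real \<times> int \<Rightarrow> complex" where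
  "stft \<sigma> a w = \<sigma> (modulate w (translate a window))"

definition M1_norm :: "(int \<times> real \<Rightarrow> complex) \<Rightarrow> ennreal" where
  "M1_norm F = (\<integral>\<^sup>+(a, w). ennreal (cmod (stft (functional_of F) a w)) \<partial>(ZT \<Otimes>\<^sub>M TZ))"

definition tf_span :: "(int \<times> real \<Rightarrow> complex) set" where
  "tf_span = {F. \<exists>I c. finite I \<and> F = (\<lambda>z. \<Sum>(a, w)\<in>I. c a w * modulate w (translate a window) z)}"

text \<open>The norm dominates the supremum norm, so the completion of the span is realised as its closure
  within the continuous functions on \<open>\<int> \<times> \<real>/\<int>\<close>.\<close>

definition M1 :: "(int \<times> real \<Rightarrow> complex) set" where
  "M1 = {F. continuous_on UNIV F \<and> (\<forall>x \<xi>. F (x, \<xi> + 1) = F (x, \<xi>)) \<and>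
            (\<forall>\<epsilon>>0. \<exists>P\<in>tf_span. M1_norm (\<lambda>z. F z - P z) < ennreal \<epsilon>)}"

text \<open>Values of a functional outside \<^const>\<open>M1\<close> are unconstrained and never used.\<close>

definition Minf :: "functional set" where
  "Minf = {\<sigma>. (\<forall>F\<in>M1. \<forall>G\<in>M1. \<sigma> (\<lambda>z. F z + G z) = \<sigma> F + \<sigma> G) \<and>
              (\<forall>c. \<forall>F\<in>M1. \<sigma> (\<lambda>z. c * F z) = cnj c * \<sigma> F) \<and>
              (\<exists>C. \<forall>F\<in>M1. ennreal (cmod (\<sigma> F)) \<le> ennreal C * M1_norm F)}"

definition J :: "int \<times> real \<Rightarrow> real \<times> int" where
  "J = (\<lambda>(x, \<xi>). (- \<xi>, x))"

definition tensor_one :: "(int \<Rightarrow> real) \<Rightarrow> int \<times> real \<Rightarrow> real" where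
  "tensor_one v = (\<lambda>(x, \<xi>). v x)"

definition Minf1 :: "(real \<times> int \<Rightarrow> real) \<Rightarrow> functional set" where
  "Minf1 m = {\<sigma> \<in> Minf.
     (\<Sum>\<^sub>\<infinity>u. \<integral>\<^sup>+\<omega>. (SUP a. ennreal (cmod (stft \<sigma> a (\<omega>, u)))) * ennreal (m (\<omega>, u)) \<partial>circle) < \<infinity>}"

text \<open>For a functional given by a 1-periodic function \<open>s\<close>, this is the functional of \<open>(x, \<xi>) \<mapsto> s (x, - \<xi>)\<close>.\<close>

definition T2 :: "functional \<Rightarrow> functional" where
  "T2 \<sigma> = (\<lambda>F. \<sigma> (\<lambda>(x, \<xi>). F (x, - \<xi>)))"

definition l1 :: "(int \<Rightarrow> complex) set" where
  "l1 = {f. (\<lambda>x. cmod (f x)) summable_on UNIV}"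

definition fourier :: "(int \<Rightarrow> complex) \<Rightarrow> real \<Rightarrow> complex" where
  "fourier f \<xi> = (\<Sum>\<^sub>\<infinity>x. f x * e2pi (- (of_int x * \<xi>)))"

text \<open>Weak definition of the Kohn-Nirenberg operator: formally
  \<open>\<langle>K\<^sub>\<sigma> f, g\<rangle> = \<Sum>\<^sub>x (\<integral> \<sigma>(x,\<xi>) fourier f \<xi> * e2pi (x * \<xi>) d\<xi>) cnj (g x) = \<langle>\<sigma>, rihaczek g f\<rangle>\<close>,
  and the value at \<open>x\<close> is the pairing with the unit vector at \<open>x\<close>.  For \<open>f\<close>, \<open>g\<close> in \<open>\<ell>\<^sup>1(\<int>)\<close>, which is
  \<open>M\<^sup>1(\<int>)\<close>, the function \<open>rihaczek g f\<close> lies in \<^const>\<open>M1\<close>.\<close>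

definition rihaczek :: "(int \<Rightarrow> complex) \<Rightarrow> (int \<Rightarrow> complex) \<Rightarrow> int \<times> real \<Rightarrow> complex" where
  "rihaczek g f = (\<lambda>(x, \<xi>). g x * cnj (fourier f \<xi>) * cnj (e2pi (of_int x * \<xi>)))"

definition KN_form :: "functional \<Rightarrow> (int \<Rightarrow> complex) \<Rightarrow> (int \<Rightarrow> complex) \<Rightarrow> complex" where
  "KN_form \<sigma> f g = \<sigma> (rihaczek g f)"

definition KN :: "functional \<Rightarrow> (int \<Rightarrow> complex) \<Rightarrow> int \<Rightarrow> complex" where
  "KN \<sigma> f x = KN_form \<sigma> f (indicator {x})"

lemma integral_indicator_singleton:
  fixes c :: "'a::{real_normed_algebra_1,banach,second_countable_topology}"
  shows "integrable (count_space UNIV) (\<lambda>y. indicator {x} y * c)"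
    and "(\<integral>y. indicator {x} y * c \<partial>count_space UNIV) = c"
proof -
  have "has_bochner_integral (count_space UNIV) (\<lambda>y. indicator {x} y *\<^sub>R c) (measure (count_space UNIV) {x} *\<^sub>R c)"
    by (rule has_bochner_integral_indicator) auto
  moreover have "(\<lambda>y. indicator {x} y * c) = (\<lambda>y. indicator {x} y *\<^sub>R c)" by (auto simp: indicator_def)
  ultimately have "has_bochner_integral (count_space UNIV) (\<lambda>y. indicator {x} y * c) c"
    by (simp add: measure_count_space)
  then show "integrable (count_space UNIV) (\<lambda>y. indicator {x} y * c)"
     "(\<integral>y. indicator {x} y * c \<partial>count_space UNIV) = c" by (simp_all add: has_bochner_integral_iff)
qed

text \<open>For symbols that are functions, the weak definition is the integral formula.\<close>

lemma KN_functional_of: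
  assumes s: "s \<in> borel_measurable ZT" and bdd: "\<And>z. cmod (s z) \<le> B" and f: "f \<in> l1"
  shows "KN (functional_of s) f x = (\<integral>\<xi>. s (x, \<xi>) * fourier f \<xi> * e2pi (of_int x * \<xi>) \<partial>circle)"
proof -
  interpret circ: finite_measure circle
    by (rule finite_measureI) (simp add: circle_def emeasure_restrict_space space_restrict_space)
  have cs: "sigma_finite_measure (count_space (UNIV::int set))"
    by (rule sigma_finite_measure_count_space)
  interpret pair_sigma_finite "count_space (UNIV::int set)" circle
    using cs circ.sigma_finite_measure_axioms by (simp add: pair_sigma_finite_def)
  have nrm: "cmod (f y * e2pi t) = cmod (f y)" for y t
    by (simp add: e2pi_def norm_mult)
  have f_sum: "(\<lambda>y. cmod (f y)) summable_on UNIV"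
    using f by (simp add: l1_def)
  have fourier_le: "cmod (fourier f \<xi>) \<le> (\<Sum>\<^sub>\<infinity>y. cmod (f y))" for \<xi>
    unfolding fourier_def
    using norm_infsum_bound[of "\<lambda>y. f y * e2pi (- (of_int y * \<xi>))" UNIV] f_sum by (simp add: nrm)
  have "continuous_on UNIV (fourier f)"
  proof (rule uniform_limit_theorem)
    show "uniform_limit UNIV (\<lambda>Y \<xi>. \<Sum>y\<in>Y. f y * e2pi (- (of_int y * \<xi>))) (fourier f)
            (finite_subsets_at_top UNIV)"
      unfolding fourier_def
      by (rule Weierstrass_m_test_general[OF _ f_sum]) (simp add: nrm)
    show "\<forall>\<^sub>F Y in finite_subsets_at_top UNIV.
            continuous_on UNIV (\<lambda>\<xi>. \<Sum>y\<in>Y. f y * e2pi (- (of_int y * \<xi>)))"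
      unfolding e2pi_def by (intro always_eventually allI continuous_intros)
  qed simp
  then have fourier_meas [measurable]: "fourier f \<in> borel_measurable circle"
    unfolding circle_def
    by (intro measurable_restrict_space1) (simp add: borel_measurable_continuous_onI)
  have e_meas [measurable]: "(\<lambda>\<xi>. e2pi (of_int x * \<xi>)) \<in> borel_measurable circle"
    unfolding circle_def e2pi_def
    by (intro measurable_restrict_space1) (simp add: borel_measurable_continuous_onI continuous_intros)
  have [measurable]: "(\<lambda>\<xi>. s (x, \<xi>)) \<in> borel_measurable circle"
    using s unfolding ZT_def by measurable
  define h where "h = (\<lambda>\<xi>. s (x, \<xi>) * fourier f \<xi> * e2pi (of_int x * \<xi>))"
  have h_meas [measurable]: "h \<in> borel_measurable circle"
    unfolding h_def by measurable
  have B: "0 \<le> B"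
    using bdd[of undefined] norm_ge_zero order_trans by blast
  have "integrable circle h"
  proof (rule circ.integrable_const_bound)
    have "cmod (h \<xi>) \<le> B * (\<Sum>\<^sub>\<infinity>y. cmod (f y))" for \<xi>
      using mult_mono[OF bdd fourier_le B norm_ge_zero] by (simp add: h_def norm_mult e2pi_def)
    then show "AE \<xi> in circle. cmod (h \<xi>) \<le> B * (\<Sum>\<^sub>\<infinity>y. cmod (f y))"
      by simp
  qed (rule h_meas)
  define G where "G = (\<lambda>(y, \<xi>). indicator {x} y * h \<xi>)"
  have G_meas: "G \<in> borel_measurable (count_space UNIV \<Otimes>\<^sub>M circle)"
  proof -
    have "(\<lambda>z. indicator {x} (fst z) * h (snd z)) \<in> borel_measurable (count_space UNIV \<Otimes>\<^sub>M circle)"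
      by (intro borel_measurable_times measurable_compose[OF measurable_fst]
          measurable_compose[OF measurable_snd h_meas]) simp
    then show ?thesis
      by (simp add: G_def case_prod_beta')
  qed
  have "integrable (count_space UNIV \<Otimes>\<^sub>M circle) G"
  proof (rule Fubini_integrable[OF G_meas])
    have "(\<integral>\<xi>. norm (G (y, \<xi>)) \<partial>circle) = indicator {x} y * (\<integral>\<xi>. norm (h \<xi>) \<partial>circle)" for y
      by (simp add: G_def norm_mult indicator_def)
    then show "integrable (count_space UNIV) (\<lambda>y. \<integral>\<xi>. norm (G (y, \<xi>)) \<partial>circle)"
      by (simp add: integral_indicator_singleton(1))
    show "AE y in count_space UNIV. integrable circle (\<lambda>\<xi>. G (y, \<xi>))"
      using \<open>integrable circle h\<close> by (simp add: G_def)
  qed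
  then have "integral\<^sup>L (count_space UNIV \<Otimes>\<^sub>M circle) G
       = (\<integral>y. (\<integral>\<xi>. G (y, \<xi>) \<partial>circle) \<partial>count_space UNIV)"
    by (rule integral_fst'[symmetric])
  also have "\<dots> = (\<integral>\<xi>. h \<xi> \<partial>circle)"
    using integral_indicator_singleton(2)[of x "\<integral>\<xi>. h \<xi> \<partial>circle"] by (simp add: G_def del: integral_mult_left_zero)
  finally have "integral\<^sup>L ZT G = (\<integral>\<xi>. h \<xi> \<partial>circle)"
    unfolding ZT_def .
  moreover have "s z * cnj (rihaczek (indicator {x}) f z) = G z" for z
    by (cases z) (auto simp: G_def h_def rihaczek_def indicator_def)
  ultimately show ?thesis
    by (simp add: KN_def KN_form_def functional_of_def h_def)
qed

text \<open>An operator that is bounded on \<open>\<ell>\<^sup>2(\<int>)\<close> is determined by its restriction to \<open>\<ell>\<^sup>1(\<int>)\<close>.\<close>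

definition is_matrix_of :: "(int \<Rightarrow> int \<Rightarrow> complex) \<Rightarrow> ((int \<Rightarrow> complex) \<Rightarrow> int \<Rightarrow> complex) \<Rightarrow> bool" where
  "is_matrix_of A K \<longleftrightarrow> (\<forall>f\<in>l1. \<forall>x. ((\<lambda>u. A x u * f u) has_sum K f x) UNIV)"

end

theory Submission
  imports Defs
begin

text \<open>
  Up to a factor of modulus one, the time-frequency shift of the window at position \<open>(a, \<eta>)\<close> and
  frequency \<open>(\<omega>, u)\<close> is the function \<open>mode a u\<close>, the character \<open>\<xi> \<mapsto> e2pi (u * \<xi>)\<close> on the fibre over \<open>a\<close>:
  translating the window along the circle does nothing, and the modulation by \<open>\<omega>\<close> only contributes the
  constant \<open>e2pi (a * \<omega>)\<close>.  Hence the short-time Fourier transform of a symbol \<open>\<sigma>\<close> carries exactly the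
  numbers \<open>\<sigma> (mode a u)\<close>, and its modulus does not depend on \<open>\<eta>\<close> and \<open>\<omega>\<close>.

  The same numbers are the matrix entries of the operator.  The Rihaczek distribution of the unit vectors
  at \<open>x\<close> and \<open>u\<close> is \<open>mode x (u - x)\<close>, so the entry at \<open>(x, u)\<close> must be \<open>\<sigma> (mode x (u - x))\<close>.  That this
  matrix represents the operator on all of \<open>\<ell>\<^sup>1\<close> (\<open>is_matrix_of_KN\<close>) rests on the \<open>M\<^sup>1\<close> norm being the
  \<open>\<ell>\<^sup>1\<close> norm of the Fourier coefficients on all fibres (\<open>M1_norm_eq\<close>, \<open>M1_norm_fibre_series\<close>): an
  absolutely convergent Fourier series on one fibre converges in \<open>M\<^sup>1\<close>, and \<open>\<sigma>\<close> may be applied term by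
  term (\<open>Minf_fibre_series\<close>).

  Reflecting the circle variable exchanges \<open>mode a u\<close> and \<open>mode a (- u)\<close>.  Therefore the transform of
  \<open>T2 \<sigma>\<close> at position \<open>a\<close> and frequency \<open>u\<close> has the modulus of \<open>\<sigma> (mode a (- u))\<close>, which is the matrix
  entry at \<open>(a, a - u)\<close>, on the \<open>u\<close>-th diagonal (\<open>stft_T2\<close>).  The supremum over positions is the
  supremum along that diagonal, the integral over \<open>\<omega>\<close> is over a constant and a space of mass one, and the
  weight \<open>v \<otimes> 1\<close> composed with the inverse of \<open>J\<close> is \<open>v u\<close>: both conditions ask for the finiteness of
  one and the same sum.  What remains is that \<open>T2\<close> preserves \<^const>\<open>Minf\<close>, which follows from the
  invariance of \<^const>\<open>M1\<close> and its norm under the reflection (\<open>reflect_in_M1\<close>).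
\<close>

section \<open>Characters and modes\<close>

definition mode :: "int \<Rightarrow> int \<Rightarrow> int \<times> real \<Rightarrow> complex" where
  "mode a u = (\<lambda>(x, \<xi>). indicator {a} x * e2pi (of_int u * \<xi>))"

definition fibre_series :: "int \<Rightarrow> (int \<Rightarrow> complex) \<Rightarrow> int \<times> real \<Rightarrow> complex" where
  "fibre_series a c = (\<lambda>(x, \<xi>). indicator {a} x * (\<Sum>\<^sub>\<infinity>u. c u * e2pi (of_int u * \<xi>)))"

definition reflect :: "(int \<times> real \<Rightarrow> complex) \<Rightarrow> int \<times> real \<Rightarrow> complex" where
  "reflect F = (\<lambda>(x, \<xi>). F (x, - \<xi>))"

lemma e2pi_add: "e2pi (s + t) = e2pi s * e2pi t"
  by (simp add: e2pi_def cis_mult algebra_simps)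

lemma cnj_e2pi: "cnj (e2pi t) = e2pi (- t)"
  by (simp add: e2pi_def cis_cnj)

lemma norm_e2pi [simp]: "cmod (e2pi t) = 1"
  by (simp add: e2pi_def)

lemma e2pi_of_int [simp]: "e2pi (of_int n) = 1"
  using cis_multiple_2pi[of "of_int n"] by (simp add: e2pi_def mult.commute)

lemma e2pi_0 [simp]: "e2pi 0 = 1"
  by (simp add: e2pi_def)

lemma continuous_on_e2pi [continuous_intros]:
  "continuous_on S g \<Longrightarrow> continuous_on S (\<lambda>x. e2pi (g x))"
  unfolding e2pi_def by (intro continuous_intros)

text \<open>The window is constant along the circle, so the translation by \<open>\<eta>\<close> leaves no trace.\<close>

lemma modulate_translate_window:
  "modulate (\<omega>, u) (translate (a, \<eta>) window) = (\<lambda>z. e2pi (of_int a * \<omega>) * mode a u z)"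
  by (auto simp: modulate_def translate_def window_def mode_def fun_eq_iff indicator_def
      e2pi_add mult.commute)

lemma mode_eq_fibre_series: "mode a u = fibre_series a (\<lambda>k. if k = u then 1 else 0)"
proof -
  have "(\<Sum>\<^sub>\<infinity>k. (if k = u then 1 else 0) * e2pi (of_int k * \<xi>)) = e2pi (of_int u * \<xi>)" for \<xi>
    by (subst infsum_cong_neutral[where T = "{u}" and g = "\<lambda>k. e2pi (of_int k * \<xi>)"]) auto
  then show ?thesis
    by (simp add: mode_def fibre_series_def fun_eq_iff)
qed

section \<open>Integration over the circle\<close>

lemma emeasure_circle: "emeasure circle (space circle) = 1"
  by (simp add: circle_def emeasure_restrict_space space_restrict_space)

interpretation circle: finite_measure circle
  by (rule finite_measureI) (simp add: emeasure_circle)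

lemma measure_circle: "measure circle (space circle) = 1"
  by (simp add: measure_def emeasure_circle)

lemma space_circle: "space circle = {0..<1}"
  by (simp add: circle_def space_restrict_space)

lemma continuous_measurable_circle:
  fixes h :: "real \<Rightarrow> complex"
  assumes "continuous_on UNIV h"
  shows "h \<in> borel_measurable circle"
  unfolding circle_def
  by (intro measurable_restrict_space1) (simp add: borel_measurable_continuous_onI assms)

text \<open>Closing the fundamental domain changes a null set only, and makes the fundamental theorem of
  calculus and the substitution \<open>\<xi> \<mapsto> 1 - \<xi>\<close> applicable.\<close>

lemma circle_integral:
  fixes h :: "real \<Rightarrow> complex"
  assumes "continuous_on UNIV h"
  shows "(\<integral>\<xi>. h \<xi> \<partial>circle) = (\<integral>\<xi>. indicator {0..1} \<xi> *\<^sub>R h \<xi> \<partial>lborel)"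
proof -
  have [measurable]: "h \<in> borel_measurable borel"
    by (simp add: borel_measurable_continuous_onI assms)
  have "(\<integral>\<xi>. h \<xi> \<partial>circle) = (\<integral>\<xi>. indicator {0..<1} \<xi> *\<^sub>R h \<xi> \<partial>lborel)"
    unfolding circle_def by (rule integral_restrict_space) auto
  also have "\<dots> = (\<integral>\<xi>. indicator {0..1} \<xi> *\<^sub>R h \<xi> \<partial>lborel)"
    by (rule integral_cong_AE) (use AE_lborel_singleton[of "1::real"] in
        \<open>auto simp: indicator_def elim!: eventually_mono\<close>)
  finally show ?thesis .
qed

lemma circle_integrable:
  fixes h :: "real \<Rightarrow> complex"
  assumes "continuous_on UNIV h"
  shows "integrable circle h"
proof -
  have "compact (h ` {0..1})"
    using assms by (intro compact_continuous_image continuous_on_subset[OF assms]) auto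
  then obtain B where "\<forall>\<xi>\<in>{0..1}. cmod (h \<xi>) \<le> B"
    by (meson bounded_iff compact_imp_bounded imageI)
  then show ?thesis
    by (intro circle.integrable_const_bound[where B = B] continuous_measurable_circle assms AE_I2)
      (auto simp: space_circle)
qed

lemma circle_integral_reflect:
  fixes h :: "real \<Rightarrow> complex"
  assumes h: "continuous_on UNIV h" and per: "\<And>\<xi>. h (\<xi> + 1) = h \<xi>"
  shows "(\<integral>\<xi>. h (- \<xi>) \<partial>circle) = (\<integral>\<xi>. h \<xi> \<partial>circle)"
proof -
  have h': "continuous_on UNIV (\<lambda>\<xi>. h (- \<xi>))"
    by (rule continuous_on_compose2[OF h]) (auto intro!: continuous_intros)
  have "(\<integral>\<xi>. h \<xi> \<partial>circle) = (\<integral>\<xi>. indicator {0..1} (1 + - 1 * \<xi>) *\<^sub>R h (1 + - 1 * \<xi>) \<partial>lborel)"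
    unfolding circle_integral[OF h]
    by (subst lborel_integral_real_affine[where c = "-1" and t = 1]) auto
  also have "\<dots> = (\<integral>\<xi>. indicator {0..1} \<xi> *\<^sub>R h (- \<xi>) \<partial>lborel)"
    using per[of "- _"] by (intro Bochner_Integration.integral_cong) (auto simp: indicator_def algebra_simps)
  finally show ?thesis
    by (simp add: circle_integral[OF h'])
qed

lemma circle_integral_e2pi: "(\<integral>\<xi>. e2pi (of_int k * \<xi>) \<partial>circle) = (if k = 0 then 1 else 0)"
proof (cases "k = 0")
  case True
  then show ?thesis by (simp add: measure_circle)
next
  case False
  let ?F = "\<lambda>\<xi>. e2pi (of_int k * \<xi>) / (2 * pi * of_int k * \<i>)"
  have c: "continuous_on S (\<lambda>\<xi>. e2pi (of_int k * \<xi>))" for S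
    by (intro continuous_intros)
  have "(?F has_vector_derivative e2pi (of_int k * \<xi>)) (at \<xi> within {0..1})" for \<xi>
  proof -
    have "((\<lambda>z. exp (2 * pi * of_int k * \<i> * z) / (2 * pi * of_int k * \<i>)) has_field_derivative
        exp (2 * pi * of_int k * \<i> * of_real \<xi>)) (at (of_real \<xi>))"
      using False by (auto intro!: derivative_eq_intros)
    from has_vector_derivative_real_field[OF this]
    show ?thesis
      unfolding e2pi_def cis_conv_exp
      by (auto simp: mult_ac intro: has_vector_derivative_at_within)
  qed
  from integral_FTC_Icc[OF _ this c]
  have "(\<integral>\<xi>. indicator {0..1} \<xi> *\<^sub>R e2pi (of_int k * \<xi>) \<partial>lborel) = ?F 1 - ?F 0"
    by simp
  also have "\<dots> = 0" by simp
  finally show ?thesis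
    using False by (simp add: circle_integral[OF c])
qed

section \<open>Absolutely convergent Fourier series\<close>

lemma series_summable:
  assumes "(\<lambda>u. cmod (c u)) summable_on A"
  shows "(\<lambda>u. cmod (c u * e2pi (g u))) summable_on A"
  using assms by (simp add: norm_mult)

lemma continuous_series:
  assumes "c \<in> l1"
  shows "continuous_on UNIV (\<lambda>\<xi>. \<Sum>\<^sub>\<infinity>u. c u * e2pi (of_int u * \<xi>))"
proof (rule uniform_limit_theorem)
  show "uniform_limit UNIV (\<lambda>Y \<xi>. \<Sum>u\<in>Y. c u * e2pi (of_int u * \<xi>))
      (\<lambda>\<xi>. \<Sum>\<^sub>\<infinity>u. c u * e2pi (of_int u * \<xi>)) (finite_subsets_at_top UNIV)"
    using assms by (intro Weierstrass_m_test_general[where M = "\<lambda>u. cmod (c u)"])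
      (auto simp: norm_mult l1_def)
  show "\<forall>\<^sub>F Y in finite_subsets_at_top UNIV.
      continuous_on UNIV (\<lambda>\<xi>. \<Sum>u\<in>Y. c u * e2pi (of_int u * \<xi>))"
    by (intro always_eventually allI continuous_intros)
qed simp

text \<open>Cutting a summable sequence at a finite set leaves summable pieces, and the piece outside has small
  norm; this is the source of every approximation below.\<close>

lemma l1_cut:
  assumes "c \<in> l1"
  shows "((\<lambda>Y. \<Sum>\<^sub>\<infinity>u. cmod (if u \<in> Y then 0 else c u)) \<longlongrightarrow> 0) (finite_subsets_at_top UNIV)"
    and "(\<lambda>u. if u \<in> Y then 0 else c u) \<in> l1" and "(\<lambda>u. if u \<in> Y then c u else 0) \<in> l1"
proof -
  have s: "(\<lambda>u. cmod (c u)) summable_on UNIV"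
    using assms by (simp add: l1_def)
  show l: "(\<lambda>u. if u \<in> Y then 0 else c u) \<in> l1" for Y
    unfolding l1_def by (auto intro: summable_on_comparison_test[OF s])
  show "(\<lambda>u. if u \<in> Y then c u else 0) \<in> l1"
    unfolding l1_def by (auto intro: summable_on_comparison_test[OF s])
  have "((\<lambda>Y. \<Sum>u\<in>Y. cmod (c u)) \<longlongrightarrow> (\<Sum>\<^sub>\<infinity>u. cmod (c u))) (finite_subsets_at_top UNIV)"
    using s by (rule infsum_tendsto)
  then have "((\<lambda>Y. (\<Sum>\<^sub>\<infinity>u. cmod (c u)) - (\<Sum>u\<in>Y. cmod (c u))) \<longlongrightarrow> 0) (finite_subsets_at_top UNIV)"
    by (auto intro: tendsto_eq_intros)
  moreover have "(\<Sum>\<^sub>\<infinity>u. cmod (c u)) - (\<Sum>u\<in>Y. cmod (c u))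
      = (\<Sum>\<^sub>\<infinity>u. cmod (if u \<in> Y then 0 else c u))" if "finite Y" for Y
  proof -
    have "(\<Sum>\<^sub>\<infinity>u. cmod (if u \<in> Y then 0 else c u)) = (\<Sum>\<^sub>\<infinity>u\<in>UNIV - Y. cmod (c u))"
      by (rule infsum_cong_neutral) auto
    also have "\<dots> = (\<Sum>\<^sub>\<infinity>u. cmod (c u)) - (\<Sum>\<^sub>\<infinity>u\<in>Y. cmod (c u))"
      by (rule infsum_Diff) (use s that in auto)
    finally show ?thesis using that by simp
  qed
  then have "\<forall>\<^sub>F Y in finite_subsets_at_top UNIV. (\<Sum>\<^sub>\<infinity>u. cmod (c u)) - (\<Sum>u\<in>Y. cmod (c u))
      = (\<Sum>\<^sub>\<infinity>u. cmod (if u \<in> Y then 0 else c u))"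
    by (rule eventually_finite_subsets_at_top_weakI)
  ultimately show "((\<lambda>Y. \<Sum>\<^sub>\<infinity>u. cmod (if u \<in> Y then 0 else c u)) \<longlongrightarrow> 0) (finite_subsets_at_top UNIV)"
    by (rule Lim_transform_eventually)
qed

lemma series_split:
  assumes "c \<in> l1" "finite Y"
  shows "(\<Sum>\<^sub>\<infinity>u. c u * e2pi (g u)) =
    (\<Sum>u\<in>Y. c u * e2pi (g u)) + (\<Sum>\<^sub>\<infinity>u. (if u \<in> Y then 0 else c u) * e2pi (g u))"
proof -
  have s: "(\<lambda>u. c u * e2pi (g u)) summable_on UNIV"
    using assms series_summable[of c UNIV g] by (auto simp: l1_def intro: abs_summable_summable)
  have "(\<Sum>\<^sub>\<infinity>u. (if u \<in> Y then 0 else c u) * e2pi (g u)) = (\<Sum>\<^sub>\<infinity>u\<in>UNIV - Y. c u * e2pi (g u))"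
    by (rule infsum_cong_neutral) auto
  also have "\<dots> = (\<Sum>\<^sub>\<infinity>u. c u * e2pi (g u)) - (\<Sum>\<^sub>\<infinity>u\<in>Y. c u * e2pi (g u))"
    by (rule infsum_Diff) (use s assms in auto)
  finally show ?thesis using assms by simp
qed

lemma norm_series_le:
  assumes "c \<in> l1"
  shows "cmod (\<Sum>\<^sub>\<infinity>u. c u * e2pi (g u)) \<le> (\<Sum>\<^sub>\<infinity>u. cmod (c u))"
  using norm_infsum_bound[of "\<lambda>u. c u * e2pi (g u)" UNIV] series_summable[of c UNIV g] assms
  by (simp add: norm_mult l1_def)

text \<open>For a trigonometric polynomial this is orthogonality of the characters.  The general case follows by
  cutting the series at a finite set: the integral of the remainder is at most the \<open>\<ell>\<^sup>1\<close> norm of the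
  remaining coefficients.\<close>

lemma fourier_coefficient_series:
  assumes c: "c \<in> l1"
  shows "(\<integral>\<xi>. (\<Sum>\<^sub>\<infinity>u. c u * e2pi (of_int u * \<xi>)) * e2pi (- (of_int n * \<xi>)) \<partial>circle) = c n"
    (is "?I c = _")
proof (rule tendsto_unique)
  let ?c = "\<lambda>Y u. if u \<in> Y then 0 else c u"
  let ?E = "\<lambda>c \<xi>. (\<Sum>\<^sub>\<infinity>u. c u * e2pi (of_int u * \<xi>)) * e2pi (- (of_int n * \<xi>))"
  have cont: "continuous_on UNIV (?E c)" if "c \<in> l1" for c
    by (intro continuous_intros continuous_series that)
  \<comment> \<open>The polynomial part over \<open>Y\<close> has the coefficient \<open>c n\<close> at \<open>n\<close> as soon as \<open>Y\<close> contains \<open>n\<close>.\<close>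
  have eq: "(if n \<in> Y then c n else 0) = ?I c - ?I (?c Y)" if Y: "finite Y" for Y
  proof -
    have "?E c \<xi> = (\<Sum>u\<in>Y. c u * e2pi (of_int (u - n) * \<xi>)) + ?E (?c Y) \<xi>" for \<xi>
      by (subst series_split[OF c Y])
        (simp add: distrib_right sum_distrib_right mult.assoc left_diff_distrib flip: e2pi_add)
    then have "?I c = (\<integral>\<xi>. (\<Sum>u\<in>Y. c u * e2pi (of_int (u - n) * \<xi>)) + ?E (?c Y) \<xi> \<partial>circle)"
      by simp
    also have "\<dots> = (\<integral>\<xi>. (\<Sum>u\<in>Y. c u * e2pi (of_int (u - n) * \<xi>)) \<partial>circle) + ?I (?c Y)"
      by (intro Bochner_Integration.integral_add circle_integrable cont l1_cut c continuous_intros)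
    also have "(\<integral>\<xi>. (\<Sum>u\<in>Y. c u * e2pi (of_int (u - n) * \<xi>)) \<partial>circle)
        = (\<Sum>u\<in>Y. \<integral>\<xi>. c u * e2pi (of_int (u - n) * \<xi>) \<partial>circle)"
      by (intro Bochner_Integration.integral_sum circle_integrable continuous_intros)
    also have "\<dots> = (\<Sum>u\<in>Y. if u = n then c u else 0)"
      using circle_integral_e2pi[of "_ - n"] by (intro sum.cong) (auto simp del: of_int_diff)
    also have "\<dots> = (if n \<in> Y then c n else 0)"
      using Y by simp
    finally show ?thesis by simp
  qed
  have "cmod (?I (?c Y)) \<le> (\<Sum>\<^sub>\<infinity>u. cmod (?c Y u))" for Y
  proof -
    have "cmod (?I (?c Y)) \<le> (\<integral>\<xi>. (\<Sum>\<^sub>\<infinity>u. cmod (?c Y u)) \<partial>circle)"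
      by (rule Bochner_Integration.integral_norm_bound_integral)
        (auto intro!: circle_integrable cont l1_cut c norm_series_le simp: norm_mult)
    then show ?thesis by (simp add: measure_circle)
  qed
  then have "((\<lambda>Y. ?I (?c Y)) \<longlongrightarrow> 0) (finite_subsets_at_top UNIV)"
    by (intro Lim_null_comparison[OF always_eventually l1_cut(1)[OF c]]) auto
  then have "((\<lambda>Y. ?I c - ?I (?c Y)) \<longlongrightarrow> ?I c) (finite_subsets_at_top UNIV)"
    by (auto intro: tendsto_eq_intros)
  then show "((\<lambda>Y. if n \<in> Y then c n else 0) \<longlongrightarrow> ?I c) (finite_subsets_at_top UNIV)"
    by (rule Lim_transform_eventually)
      (intro eventually_finite_subsets_at_top_weakI eq[symmetric])
  have "\<forall>\<^sub>F Y in finite_subsets_at_top UNIV. c n = (if n \<in> Y then c n else 0)"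
    by (subst eventually_finite_subsets_at_top) (auto intro!: exI[of _ "{n}"])
  then show "((\<lambda>Y. if n \<in> Y then c n else 0) \<longlongrightarrow> c n) (finite_subsets_at_top UNIV)"
    by (rule Lim_transform_eventually[OF tendsto_const])
qed simp


section \<open>The norm as a sum of Fourier coefficients\<close>

lemma functional_of_scale: "functional_of F (\<lambda>z. c * G z) = cnj c * functional_of F G"
proof -
  have "F z * cnj (c * G z) = cnj c * (F z * cnj (G z))" for z
    by simp
  then show ?thesis
    unfolding functional_of_def by (simp only: integral_mult_right_zero)
qed

lemma fourier_unit: "fourier (indicator {u}) \<xi> = e2pi (- (of_int u * \<xi>))"
  unfolding fourier_def
  by (subst infsum_cong_neutral[where T = "{u}" and g = "\<lambda>k. e2pi (- (of_int k * \<xi>))"]) auto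

lemma indicator_in_l1: "indicator {u} \<in> l1"
proof -
  have "(\<lambda>x. cmod (indicator {u} x)) summable_on UNIV \<longleftrightarrow> (\<lambda>x. 1::real) summable_on {u}"
    by (rule summable_on_cong_neutral) (auto simp: indicator_def)
  then show ?thesis by (simp add: l1_def)
qed

text \<open>The pairing with a mode sees one fibre only.  To reduce the integral over the product to one over the
  circle, the fibre is cut out of \<open>F\<close> as a bounded symbol \<open>s\<close>; then the pairing is the entry of the
  Kohn-Nirenberg operator with symbol \<open>s\<close> at row \<open>a\<close> and column \<open>a + n\<close>, given by its integral
  formula.\<close>

lemma functional_of_mode:
  assumes F: "continuous_on UNIV F"
  shows "functional_of F (mode a n) = (\<integral>\<xi>. F (a, \<xi>) * e2pi (- (of_int n * \<xi>)) \<partial>circle)"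
proof -
  have cont: "continuous_on UNIV (\<lambda>\<xi>. F (a, \<xi>))"
    by (rule continuous_on_compose2[OF F]) (auto intro!: continuous_intros)
  then have "compact ((\<lambda>\<xi>. F (a, \<xi>)) ` {0..1})"
    by (intro compact_continuous_image continuous_on_subset[OF cont]) auto
  then obtain B where B: "\<forall>\<xi>\<in>{0..1}. cmod (F (a, \<xi>)) \<le> B"
    by (meson bounded_iff compact_imp_bounded imageI)
  define s where "s = (\<lambda>(x, \<xi>). if x = a then indicator {0..1} \<xi> * F (a, \<xi>) else 0)"
  have "s \<in> borel_measurable ZT"
    unfolding ZT_def
  proof (rule measurable_pair_measure_countable1)
    fix x
    have "(\<lambda>\<xi>. indicator {0..1} \<xi> * F (a, \<xi>)) \<in> borel_measurable circle"
      unfolding circle_def by (intro measurable_restrict_space1 borel_measurable_times)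
        (auto intro!: borel_measurable_continuous_onI cont)
    then show "(\<lambda>y. s (x, y)) \<in> borel_measurable circle"
      by (simp add: s_def)
  qed simp
  moreover have "cmod (s z) \<le> \<bar>B\<bar>" for z
    using B by (cases z) (auto simp: s_def indicator_def intro: order_trans[OF _ abs_ge_self])
  ultimately have "KN (functional_of s) (indicator {a + n}) a
      = (\<integral>\<xi>. s (a, \<xi>) * fourier (indicator {a + n}) \<xi> * e2pi (of_int a * \<xi>) \<partial>circle)"
    by (rule KN_functional_of) (rule indicator_in_l1)
  also have "\<dots> = (\<integral>\<xi>. F (a, \<xi>) * e2pi (- (of_int n * \<xi>)) \<partial>circle)"
    by (rule Bochner_Integration.integral_cong)
      (auto simp: s_def space_circle fourier_unit mult.assoc distrib_right simp flip: e2pi_add)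
  also have "KN (functional_of s) (indicator {a + n}) a = functional_of F (mode a n)"
    unfolding KN_def KN_form_def functional_of_def
    by (rule Bochner_Integration.integral_cong)
      (auto simp: s_def ZT_def space_pair_measure space_circle rihaczek_def fourier_unit cnj_e2pi
        mode_def distrib_right indicator_def mult.assoc simp flip: e2pi_add)
  finally show ?thesis .
qed

lemma nn_integral_ZT:
  "(\<integral>\<^sup>+(x, \<xi>). g x \<partial>ZT) = (\<integral>\<^sup>+x. g x \<partial>count_space UNIV)" for g :: "int \<Rightarrow> ennreal"
proof -
  have "(\<lambda>(x, \<xi>). g x) \<in> borel_measurable (count_space UNIV \<Otimes>\<^sub>M circle)"
    by (rule measurable_pair_measure_countable1) auto
  from circle.nn_integral_fst[OF this] show ?thesis
    by (simp add: ZT_def emeasure_circle)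
qed

lemma nn_integral_TZ:
  "(\<integral>\<^sup>+(\<omega>, u). g u \<partial>TZ) = (\<integral>\<^sup>+u. g u \<partial>count_space UNIV)" for g :: "int \<Rightarrow> ennreal"
proof -
  interpret Z: sigma_finite_measure "count_space (UNIV :: int set)"
    by (rule sigma_finite_measure_count_space)
  have "(\<lambda>z. g (snd z)) \<in> borel_measurable (circle \<Otimes>\<^sub>M count_space UNIV)"
    by (rule measurable_compose[OF measurable_snd]) simp
  from Z.nn_integral_fst[OF this] show ?thesis
    by (simp add: TZ_def emeasure_circle case_prod_beta')
qed

text \<open>The integrand depends on the integer coordinates \<open>a\<close> and \<open>u\<close> only, and the two circles that are
  integrated out have mass one.\<close>

lemma M1_norm_eq:
  "M1_norm F = (\<integral>\<^sup>+a. \<integral>\<^sup>+u. ennreal (cmod (functional_of F (mode a u)))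
      \<partial>count_space UNIV \<partial>count_space UNIV)"
proof -
  interpret Z: sigma_finite_measure "count_space (UNIV :: int set)"
    by (rule sigma_finite_measure_count_space)
  interpret CZ: pair_sigma_finite circle "count_space (UNIV :: int set)" ..
  interpret TZ: sigma_finite_measure TZ
    unfolding TZ_def by (rule CZ.sigma_finite_measure_axioms)
  let ?g = "\<lambda>a u. ennreal (cmod (functional_of F (mode a u)))"
  have "M1_norm F = (\<integral>\<^sup>+z. ?g (fst (fst z)) (snd (snd z)) \<partial>(ZT \<Otimes>\<^sub>M TZ))"
    unfolding M1_norm_def stft_def
    by (intro nn_integral_cong)
      (auto simp: modulate_translate_window functional_of_scale norm_mult)
  also have "\<dots> = (\<integral>\<^sup>+x. \<integral>\<^sup>+y. ?g (fst x) (snd y) \<partial>TZ \<partial>ZT)"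
  proof -
    have 1: "(\<lambda>z. fst (fst z)) \<in> ZT \<Otimes>\<^sub>M TZ \<rightarrow>\<^sub>M count_space UNIV"
      unfolding ZT_def by measurable
    have 2: "(\<lambda>z. snd (snd z)) \<in> ZT \<Otimes>\<^sub>M TZ \<rightarrow>\<^sub>M count_space UNIV"
      unfolding TZ_def by measurable
    have "(\<lambda>z. ?g (fst (fst z)) (snd (snd z))) \<in> borel_measurable (ZT \<Otimes>\<^sub>M TZ)"
      by (rule measurable_compose_countable[OF _ 1], rule measurable_compose_countable[OF _ 2]) simp
    from TZ.nn_integral_fst[OF this] show ?thesis
      by simp
  qed
  also have "\<dots> = (\<integral>\<^sup>+a. \<integral>\<^sup>+u. ?g a u \<partial>count_space UNIV \<partial>count_space UNIV)"
    using nn_integral_TZ[of "?g _"] nn_integral_ZT[of "\<lambda>a. \<integral>\<^sup>+u. ?g a u \<partial>count_space UNIV"]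
    by (simp add: case_prod_beta')
  finally show ?thesis .
qed

section \<open>Fourier series on one fibre as test functions\<close>

lemma continuous_fibre_series:
  assumes "c \<in> l1"
  shows "continuous_on UNIV (fibre_series a c)"
proof -
  have "continuous_on UNIV (\<lambda>z::int \<times> real. indicator {a} (fst z) :: complex)"
    by (rule continuous_on_compose2[of UNIV "indicator {a}"]) (auto intro!: continuous_intros)
  moreover have "continuous_on UNIV (\<lambda>z::int \<times> real. \<Sum>\<^sub>\<infinity>u. c u * e2pi (of_int u * snd z))"
    by (rule continuous_on_compose2[OF continuous_series[OF assms]]) (auto intro!: continuous_intros)
  ultimately show ?thesis
    unfolding fibre_series_def case_prod_beta' by (rule continuous_on_mult)
qed

lemma periodic_fibre_series: "fibre_series a c (x, \<xi> + 1) = fibre_series a c (x, \<xi>)"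
  by (simp add: fibre_series_def distrib_left e2pi_add)

lemma M1_norm_fibre_series:
  assumes c: "c \<in> l1"
  shows "M1_norm (fibre_series a c) = ennreal (\<Sum>\<^sub>\<infinity>u. cmod (c u))"
proof -
  have "functional_of (fibre_series a c) (mode b n) = indicator {a} b * c n" for b n
    using fourier_coefficient_series[OF c, of n]
    by (cases "b = a") (simp_all add: functional_of_mode continuous_fibre_series c, simp_all add: fibre_series_def)
  then have "M1_norm (fibre_series a c)
      = (\<integral>\<^sup>+b. \<integral>\<^sup>+n. ennreal (cmod (indicator {a} b * c n)) \<partial>count_space UNIV \<partial>count_space UNIV)"
    by (simp add: M1_norm_eq)
  also have "\<dots> = (\<integral>\<^sup>+b. (\<integral>\<^sup>+n. ennreal (cmod (c n)) \<partial>count_space UNIV) * indicator {a} b \<partial>count_space UNIV)"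
    by (intro nn_integral_cong) (auto simp: indicator_def)
  also have "\<dots> = (\<integral>\<^sup>+n. ennreal (cmod (c n)) \<partial>count_space UNIV)"
    by (subst nn_integral_cmult_indicator) auto
  also have "\<dots> = ennreal (\<Sum>\<^sub>\<infinity>u. cmod (c u))"
  proof -
    have "Infinite_Set_Sum.abs_summable_on (\<lambda>u. cmod (c u)) UNIV"
      using c by (simp add: l1_def abs_summable_equivalent)
    then show ?thesis
      by (subst nn_integral_conv_infsetsum) (auto simp: infsetsum_infsum)
  qed
  finally show ?thesis .
qed

lemma fibre_series_finite_support:
  assumes "finite Y"
  shows "fibre_series a (\<lambda>u. if u \<in> Y then c u else 0) = (\<lambda>z. \<Sum>u\<in>Y. c u * mode a u z)"
proof -
  have "(\<Sum>\<^sub>\<infinity>u. (if u \<in> Y then c u else 0) * e2pi (of_int u * \<xi>))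
      = (\<Sum>u\<in>Y. c u * e2pi (of_int u * \<xi>))" for \<xi>
    using assms by (subst infsum_cong_neutral[where T = Y and g = "\<lambda>u. c u * e2pi (of_int u * \<xi>)"]) auto
  then show ?thesis
    by (auto simp: fibre_series_def mode_def fun_eq_iff sum_distrib_left intro!: sum.cong)
qed

lemma fibre_series_split:
  assumes "c \<in> l1" "finite Y"
  shows "fibre_series a c z = fibre_series a (\<lambda>u. if u \<in> Y then c u else 0) z + fibre_series a (\<lambda>u. if u \<in> Y then 0 else c u) z"
proof (cases z)
  case (Pair x \<xi>)
  have "fibre_series a (\<lambda>u. if u \<in> Y then c u else 0) z = indicator {a} x * (\<Sum>u\<in>Y. c u * e2pi (of_int u * \<xi>))"
    unfolding fibre_series_finite_support[OF assms(2)] Pair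
    by (auto simp: mode_def sum_distrib_left intro!: sum.cong)
  then show ?thesis
    unfolding Pair fibre_series_def case_prod_conv
    by (subst series_split[OF assms]) (simp only: distrib_left)
qed

lemma mode_sum_in_tf_span:
  assumes "finite Y"
  shows "(\<lambda>z. \<Sum>u\<in>Y. c u * mode a u z) \<in> tf_span"
proof -
  let ?p = "\<lambda>u::int. ((a, 0::real), (0::real, u))"
  have "(\<Sum>(b, w)\<in>?p ` Y. c (snd w) * modulate w (translate b window) z) = (\<Sum>u\<in>Y. c u * mode a u z)" for z
    by (subst sum.reindex) (auto simp: inj_on_def modulate_translate_window)
  then show ?thesis
    using assms unfolding tf_span_def
    by (intro CollectI exI[of _ "?p ` Y"] exI[of _ "\<lambda>b w. c (snd w)"]) auto
qed

text \<open>The partial sums lie in the span of the time-frequency shifts, and the remainder is again a fibre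
  series, whose norm is the tail of the sum of the coefficients.\<close>

lemma fibre_series_in_M1:
  assumes c: "c \<in> l1"
  shows "fibre_series a c \<in> M1"
proof -
  have "\<exists>P\<in>tf_span. M1_norm (\<lambda>z. fibre_series a c z - P z) < ennreal \<epsilon>" if "\<epsilon> > 0" for \<epsilon>
  proof -
    have "\<forall>\<^sub>F Y in finite_subsets_at_top UNIV. (\<Sum>\<^sub>\<infinity>u. cmod (if u \<in> Y then 0 else c u)) < \<epsilon>"
      using l1_cut(1)[OF c] that by (rule order_tendstoD)
    then obtain Y where Y: "finite Y" "(\<Sum>\<^sub>\<infinity>u. cmod (if u \<in> Y then 0 else c u)) < \<epsilon>"
      by (auto simp: eventually_finite_subsets_at_top)
    have "(\<lambda>z. fibre_series a c z - (\<Sum>u\<in>Y. c u * mode a u z)) = fibre_series a (\<lambda>u. if u \<in> Y then 0 else c u)"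
      using fibre_series_split[OF c Y(1)] by (simp add: fun_eq_iff fibre_series_finite_support[OF Y(1)])
    then have "M1_norm (\<lambda>z. fibre_series a c z - (\<Sum>u\<in>Y. c u * mode a u z)) < ennreal \<epsilon>"
      using Y(2) that by (simp add: M1_norm_fibre_series l1_cut(2)[OF c] ennreal_lessI)
    then show ?thesis
      by (rule bexI[where x = "\<lambda>z. \<Sum>u\<in>Y. c u * mode a u z"]) (rule mode_sum_in_tf_span[OF Y(1)])
  qed
  then show ?thesis
    by (simp add: M1_def continuous_fibre_series[OF c] periodic_fibre_series)
qed

lemma mode_in_M1: "mode a u \<in> M1"
proof -
  have "(\<lambda>k. if k = u then 1 else 0 :: complex) = indicator {u}"
    by (auto simp: indicator_def)
  then show ?thesis
    unfolding mode_eq_fibre_series by (simp only: fibre_series_in_M1 indicator_in_l1)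
qed

lemma MinfD:
  assumes "\<sigma> \<in> Minf"
  shows "F \<in> M1 \<Longrightarrow> G \<in> M1 \<Longrightarrow> \<sigma> (\<lambda>z. F z + G z) = \<sigma> F + \<sigma> G"
    and "F \<in> M1 \<Longrightarrow> \<sigma> (\<lambda>z. c * F z) = cnj c * \<sigma> F"
    and "\<exists>C. \<forall>F\<in>M1. ennreal (cmod (\<sigma> F)) \<le> ennreal C * M1_norm F"
  using assms by (simp_all add: Minf_def)

lemma Minf_fibre_series_finite_support:
  assumes \<sigma>: "\<sigma> \<in> Minf" and c: "c \<in> l1" and Y: "finite Y"
  shows "\<sigma> (fibre_series a (\<lambda>u. if u \<in> Y then c u else 0)) = (\<Sum>u\<in>Y. cnj (c u) * \<sigma> (mode a u))"
  using Y
proof induction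
  case empty
  have "fibre_series a (\<lambda>u. 0) = (\<lambda>z. 0 * mode a 0 z)"
    by (simp add: fibre_series_def fun_eq_iff)
  then show ?case
    by (simp add: MinfD(2)[OF \<sigma> mode_in_M1, of 0, simplified])
next
  case (insert k Y)
  let ?r = "\<lambda>Y u. if u \<in> Y then c u else 0"
  have r: "fibre_series a (?r Y) \<in> M1" for Y
    by (intro fibre_series_in_M1 l1_cut c)
  have k: "fibre_series a (?r {k}) = (\<lambda>z. c k * mode a k z)"
    using fibre_series_finite_support[of "{k}" a c] by simp
  have "fibre_series a (?r (insert k Y)) = (\<lambda>z. fibre_series a (?r {k}) z + fibre_series a (?r Y) z)"
    using insert by (simp only: fibre_series_finite_support finite.intros sum.insert) (simp add: fun_eq_iff)
  then have "\<sigma> (fibre_series a (?r (insert k Y))) = \<sigma> (fibre_series a (?r {k})) + \<sigma> (fibre_series a (?r Y))"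
    by (simp only: MinfD(1)[OF \<sigma> r r])
  also have "\<sigma> (fibre_series a (?r {k})) = cnj (c k) * \<sigma> (mode a k)"
    by (simp only: k MinfD(2)[OF \<sigma> mode_in_M1])
  finally show ?case
    using insert by simp
qed

text \<open>Boundedness of \<open>\<sigma>\<close> turns convergence of the series in \<open>M\<^sup>1\<close> into convergence of the values.\<close>

lemma Minf_fibre_series:
  assumes \<sigma>: "\<sigma> \<in> Minf" and c: "c \<in> l1"
  shows "((\<lambda>u. cnj (c u) * \<sigma> (mode a u)) has_sum \<sigma> (fibre_series a c)) UNIV"
proof -
  obtain C where C: "\<And>F. F \<in> M1 \<Longrightarrow> ennreal (cmod (\<sigma> F)) \<le> ennreal C * M1_norm F"
    using MinfD(3)[OF \<sigma>] by blast
  let ?t = "\<lambda>Y u. if u \<in> Y then 0 else c u"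
  have bound: "cmod (\<sigma> (fibre_series a (?t Y))) \<le> \<bar>C\<bar> * (\<Sum>\<^sub>\<infinity>u. cmod (?t Y u))" for Y
  proof -
    have nonneg: "0 \<le> (\<Sum>\<^sub>\<infinity>u. cmod (?t Y u))"
      by (rule infsum_nonneg) simp
    have "ennreal (cmod (\<sigma> (fibre_series a (?t Y)))) \<le> ennreal C * ennreal (\<Sum>\<^sub>\<infinity>u. cmod (?t Y u))"
      using C[OF fibre_series_in_M1[OF l1_cut(2)[OF c]]] by (simp add: M1_norm_fibre_series l1_cut(2)[OF c])
    \<comment> \<open>\<open>C\<close> may be negative, in which case \<open>ennreal C\<close> is zero.\<close>
    also have "\<dots> \<le> ennreal \<bar>C\<bar> * ennreal (\<Sum>\<^sub>\<infinity>u. cmod (?t Y u))"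
      by (intro mult_right_mono ennreal_leI) auto
    also have "\<dots> = ennreal (\<bar>C\<bar> * (\<Sum>\<^sub>\<infinity>u. cmod (?t Y u)))"
      using nonneg by (simp add: ennreal_mult)
    finally show ?thesis
      using nonneg by (simp add: ennreal_le_iff)
  qed
  have "((\<lambda>Y. \<bar>C\<bar> * (\<Sum>\<^sub>\<infinity>u. cmod (?t Y u))) \<longlongrightarrow> 0) (finite_subsets_at_top UNIV)"
    using tendsto_mult_left[OF l1_cut(1)[OF c], of "\<bar>C\<bar>"] by simp
  then have "((\<lambda>Y. \<sigma> (fibre_series a (?t Y))) \<longlongrightarrow> 0) (finite_subsets_at_top UNIV)"
    by (rule Lim_null_comparison[OF always_eventually, rotated]) (blast intro: bound)
  then have "((\<lambda>Y. \<sigma> (fibre_series a c) - \<sigma> (fibre_series a (?t Y))) \<longlongrightarrow> \<sigma> (fibre_series a c)) (finite_subsets_at_top UNIV)"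
    by (auto intro: tendsto_eq_intros)
  moreover have "\<sigma> (fibre_series a c) - \<sigma> (fibre_series a (?t Y)) = (\<Sum>u\<in>Y. cnj (c u) * \<sigma> (mode a u))"
    if Y: "finite Y" for Y
  proof -
    have "\<sigma> (fibre_series a c) = \<sigma> (\<lambda>z. fibre_series a (\<lambda>u. if u \<in> Y then c u else 0) z + fibre_series a (?t Y) z)"
      using fibre_series_split[OF c Y] by (intro arg_cong[where f = \<sigma>]) auto
    also have "\<dots> = \<sigma> (fibre_series a (\<lambda>u. if u \<in> Y then c u else 0)) + \<sigma> (fibre_series a (?t Y))"
      by (intro MinfD(1)[OF \<sigma>] fibre_series_in_M1 l1_cut c)
    finally show ?thesis
      using Minf_fibre_series_finite_support[OF \<sigma> c Y] by simp
  qed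
  ultimately show ?thesis
    unfolding has_sum_def
    by (elim Lim_transform_eventually) (intro eventually_finite_subsets_at_top_weakI)
qed

section \<open>The matrix of a Kohn-Nirenberg operator\<close>

text \<open>Multiplication by the character of \<open>x\<close> shifts the Fourier coefficients by \<open>x\<close>.\<close>

lemma rihaczek_unit:
  "rihaczek (indicator {x}) f = fibre_series x (\<lambda>k. cnj (f (k + x)))"
proof -
  have "cnj (fourier f \<xi>) * cnj (e2pi (of_int x * \<xi>))
      = (\<Sum>\<^sub>\<infinity>k. cnj (f (k + x)) * e2pi (of_int k * \<xi>))" for \<xi>
  proof -
    have "cnj (fourier f \<xi>) * cnj (e2pi (of_int x * \<xi>))
        = (\<Sum>\<^sub>\<infinity>u. cnj (f u) * e2pi (of_int (u - x) * \<xi>))"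
      unfolding fourier_def
      by (simp add: cnj_e2pi mult.assoc left_diff_distrib
          flip: infsum_cnj infsum_cmult_left' e2pi_add)
    also have "\<dots> = (\<Sum>\<^sub>\<infinity>k. cnj (f (k + x)) * e2pi (of_int k * \<xi>))"
      by (rule infsum_reindex_bij_witness[of _ "\<lambda>k. k + x" "\<lambda>u. u - x"]) auto
    finally show ?thesis .
  qed
  then show ?thesis
    by (auto simp: rihaczek_def fibre_series_def fun_eq_iff mult.assoc indicator_def)
qed

lemma is_matrix_of_KN:
  assumes \<sigma>: "\<sigma> \<in> Minf"
  shows "is_matrix_of (\<lambda>x u. \<sigma> (mode x (u - x))) (KN \<sigma>)"
  unfolding is_matrix_of_def
proof (intro ballI allI)
  fix f x assume f: "f \<in> l1"
  have "(\<lambda>u. cmod (f u)) summable_on UNIV \<longleftrightarrow> (\<lambda>k. cmod (f (k + x))) summable_on UNIV"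
    by (rule summable_on_reindex_bij_witness[of _ "\<lambda>k. k + x" "\<lambda>u. u - x"]) auto
  then have "(\<lambda>k. cnj (f (k + x))) \<in> l1"
    using f by (simp add: l1_def)
  from Minf_fibre_series[OF \<sigma> this, of x]
  have "((\<lambda>k. f (k + x) * \<sigma> (mode x k)) has_sum KN \<sigma> f x) UNIV"
    by (simp add: KN_def KN_form_def rihaczek_unit)
  also have "?this \<longleftrightarrow> ((\<lambda>u. \<sigma> (mode x (u - x)) * f u) has_sum KN \<sigma> f x) UNIV"
    by (rule has_sum_reindex_bij_witness[of _ "\<lambda>u. u - x" "\<lambda>k. k + x"]) auto
  finally show "((\<lambda>u. \<sigma> (mode x (u - x)) * f u) has_sum KN \<sigma> f x) UNIV" .
qed

lemma is_matrix_of_unique: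
  assumes "is_matrix_of A K" "is_matrix_of B K"
  shows "A = B"
proof (intro ext)
  fix x u
  have *: "K (indicator {u}) x = M x u" if "is_matrix_of M K" for M
  proof -
    have "((\<lambda>k. M x k * indicator {u} k) has_sum K (indicator {u}) x) UNIV"
      using that indicator_in_l1 by (simp add: is_matrix_of_def)
    also have "?this \<longleftrightarrow> ((\<lambda>k. M x k) has_sum K (indicator {u}) x) {u}"
      by (rule has_sum_cong_neutral) auto
    finally show ?thesis
      by (simp add: has_sum_finite_iff)
  qed
  show "A x u = B x u"
    using *[OF assms(1)] *[OF assms(2)] by simp
qed

section \<open>Reflection of the circle variable\<close>

lemma reflect_mode: "reflect (mode a u) = mode a (- u)"
  by (simp add: reflect_def mode_def fun_eq_iff)

lemma continuous_reflect: "continuous_on UNIV F \<Longrightarrow> continuous_on UNIV (reflect F)"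
  unfolding reflect_def case_prod_beta'
  by (rule continuous_on_compose2[of UNIV F]) (auto intro!: continuous_intros)

text \<open>Reflection negates the frequency of each Fourier coefficient, which permutes the terms of the sum that
  is the norm.\<close>

lemma M1_norm_reflect:
  assumes F: "continuous_on UNIV F" and per: "\<And>x \<xi>. F (x, \<xi> + 1) = F (x, \<xi>)"
  shows "M1_norm (reflect F) = M1_norm F"
proof -
  have coef: "functional_of (reflect F) (mode a u) = functional_of F (mode a (- u))" for a u
  proof -
    let ?h = "\<lambda>\<xi>. F (a, \<xi>) * e2pi (of_int u * \<xi>)"
    have "continuous_on UNIV ?h"
      by (intro continuous_intros continuous_on_compose2[OF F]) auto
    moreover have "?h (\<xi> + 1) = ?h \<xi>" for \<xi>
      by (simp add: per distrib_left e2pi_add)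
    ultimately have "(\<integral>\<xi>. ?h (- \<xi>) \<partial>circle) = (\<integral>\<xi>. ?h \<xi> \<partial>circle)"
      by (rule circle_integral_reflect)
    then show ?thesis
      by (simp add: functional_of_mode continuous_reflect F) (simp add: reflect_def)
  qed
  have "(\<integral>\<^sup>+u. g (- u) \<partial>count_space UNIV) = (\<integral>\<^sup>+u. g u \<partial>count_space UNIV)" for g :: "int \<Rightarrow> ennreal"
    by (rule nn_integral_bij_count_space) (auto intro: bij_betwI[where g = uminus])
  from this[of "\<lambda>u. ennreal (cmod (functional_of F (mode _ u)))"] show ?thesis
    by (simp add: M1_norm_eq coef)
qed

lemma tf_span_regular:
  assumes "P \<in> tf_span"
  shows "continuous_on UNIV P" and "P (x, \<xi> + 1) = P (x, \<xi>)" and "reflect P \<in> tf_span"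
proof -
  obtain I c where I: "finite I" and P: "P = (\<lambda>z. \<Sum>(a, w)\<in>I. c a w * modulate w (translate a window) z)"
    using assms by (auto simp: tf_span_def)
  have mode: "continuous_on UNIV (mode a u)" "mode a u (x, \<xi> + 1) = mode a u (x, \<xi>)" for a u
    using mode_in_M1[of a u] by (auto simp: M1_def)
  show "continuous_on UNIV P"
    unfolding P by (auto simp: modulate_translate_window intro!: continuous_intros mode)
  show "P (x, \<xi> + 1) = P (x, \<xi>)"
    unfolding P by (rule sum.cong) (auto simp: modulate_translate_window mode)
  let ?p = "\<lambda>(a :: int \<times> real, w :: real \<times> int). (a, (fst w, - snd w))"
  have "reflect P z = (\<Sum>(a, w)\<in>?p ` I. c a (fst w, - snd w) * modulate w (translate a window) z)" for z
  proof -
    have "inj_on ?p I"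
      by (auto simp: inj_on_def)
    moreover have "mode a u (x, - \<xi>) = mode a (- u) (x, \<xi>)" for a u x \<xi>
      by (simp add: mode_def)
    ultimately show ?thesis
      by (cases z) (auto simp: sum.reindex P reflect_def modulate_translate_window intro!: sum.cong)
  qed
  then show "reflect P \<in> tf_span"
    unfolding tf_span_def using I
    by (intro CollectI exI[of _ "?p ` I"] exI[of _ "\<lambda>a w. c a (fst w, - snd w)"]) auto
qed

lemma reflect_in_M1:
  assumes F: "F \<in> M1"
  shows "reflect F \<in> M1" and "M1_norm (reflect F) = M1_norm F"
proof -
  have cont: "continuous_on UNIV F" and per: "\<And>x \<xi>. F (x, \<xi> + 1) = F (x, \<xi>)"
    and approx: "\<And>\<epsilon>. \<epsilon> > 0 \<Longrightarrow> \<exists>P\<in>tf_span. M1_norm (\<lambda>z. F z - P z) < ennreal \<epsilon>"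
    using F by (auto simp: M1_def)
  show "M1_norm (reflect F) = M1_norm F"
    by (rule M1_norm_reflect[OF cont per])
  have "\<exists>P\<in>tf_span. M1_norm (\<lambda>z. reflect F z - P z) < ennreal \<epsilon>" if \<epsilon>: "\<epsilon> > 0" for \<epsilon>
  proof -
    obtain P where P: "P \<in> tf_span" "M1_norm (\<lambda>z. F z - P z) < ennreal \<epsilon>"
      using approx[OF \<epsilon>] by blast
    have "M1_norm (\<lambda>z. reflect F z - reflect P z) = M1_norm (reflect (\<lambda>z. F z - P z))"
      by (simp add: reflect_def case_prod_beta')
    also have "\<dots> = M1_norm (\<lambda>z. F z - P z)"
      by (rule M1_norm_reflect)
        (auto intro!: continuous_intros cont tf_span_regular[OF P(1)]
          simp: per tf_span_regular[OF P(1)])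
    finally show ?thesis
      using P(2) by (intro bexI[where x = "reflect P"] tf_span_regular(3)[OF P(1)]) simp
  qed
  moreover have "reflect F (x, \<xi> + 1) = reflect F (x, \<xi>)" for x \<xi>
    using per[of x "- \<xi> - 1"] by (simp add: reflect_def)
  ultimately show "reflect F \<in> M1"
    by (simp add: M1_def continuous_reflect cont)
qed

lemma T2_eq: "T2 \<sigma> F = \<sigma> (reflect F)"
  by (simp add: T2_def reflect_def)

text \<open>Here the full space of test functions matters, not just the modes: reflection is a linear isometry
  of \<^const>\<open>M1\<close>.\<close>

lemma T2_in_Minf:
  assumes \<sigma>: "\<sigma> \<in> Minf"
  shows "T2 \<sigma> \<in> Minf"
proof -
  obtain C where C: "\<And>F. F \<in> M1 \<Longrightarrow> ennreal (cmod (\<sigma> F)) \<le> ennreal C * M1_norm F"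
    using MinfD(3)[OF \<sigma>] by blast
  have "reflect (\<lambda>z. F z + G z) = (\<lambda>z. reflect F z + reflect G z)"
    "reflect (\<lambda>z. c * F z) = (\<lambda>z. c * reflect F z)" for F G c
    by (auto simp: reflect_def)
  moreover have "\<forall>F\<in>M1. ennreal (cmod (\<sigma> (reflect F))) \<le> ennreal C * M1_norm F"
    using C[OF reflect_in_M1(1)] by (simp add: reflect_in_M1(2))
  ultimately show ?thesis
    unfolding Minf_def by (simp add: T2_eq MinfD(1,2)[OF \<sigma>] reflect_in_M1) blast
qed

section \<open>Comparison of the two conditions\<close>

lemma stft_T2:
  assumes "\<sigma> \<in> Minf"
  shows "cmod (stft (T2 \<sigma>) (a, \<eta>) (\<omega>, u)) = cmod (\<sigma> (mode a (- u)))"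
  using MinfD(2)[OF T2_in_Minf[OF assms] mode_in_M1]
  by (simp add: stft_def modulate_translate_window norm_mult) (simp add: T2_eq reflect_mode)

lemma inv_J: "inv J (\<omega>, u) = (u, - \<omega>)"
  by (rule inv_f_eq) (auto simp: J_def inj_def)

theorem lemma6p1:
  fixes v :: "int \<Rightarrow> real" and \<sigma> :: functional
  assumes "admissible_weight v" and "\<sigma> \<in> Minf"
  shows "(\<exists>!A. is_matrix_of A (KN \<sigma>)) \<and>
    (\<forall>A. is_matrix_of A (KN \<sigma>) \<longrightarrow>
       (A \<in> C_class v \<longleftrightarrow> T2 \<sigma> \<in> Minf1 (tensor_one v \<circ> inv J)))"
proof -
  let ?A = "\<lambda>x u. \<sigma> (mode x (u - x))"
  have A: "is_matrix_of ?A (KN \<sigma>)"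
    using assms(2) by (rule is_matrix_of_KN)
  have "(SUP a. ennreal (cmod (stft (T2 \<sigma>) a (\<omega>, u)))) = (SUP i. ennreal (cmod (?A i (i - u))))" for \<omega> u
  proof (rule SUP_eq)
    fix a :: "int \<times> real"
    show "\<exists>i\<in>UNIV. ennreal (cmod (stft (T2 \<sigma>) a (\<omega>, u))) \<le> ennreal (cmod (?A i (i - u)))"
      by (cases a) (auto simp: stft_T2[OF assms(2)])
  next
    fix i :: int
    show "\<exists>a\<in>UNIV. ennreal (cmod (?A i (i - u))) \<le> ennreal (cmod (stft (T2 \<sigma>) a (\<omega>, u)))"
      by (rule bexI[of _ "(i, 0)"]) (auto simp: stft_T2[OF assms(2)])
  qed
  then have "?A \<in> C_class v \<longleftrightarrow> T2 \<sigma> \<in> Minf1 (tensor_one v \<circ> inv J)"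
    by (simp add: C_class_def Minf1_def T2_in_Minf[OF assms(2)] inv_J tensor_one_def emeasure_circle)
  with A show ?thesis
    using is_matrix_of_unique by blast
qed

end
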